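(* Let $\nu>0$ and $x\in(0,2)$. Then $$\mathbf L_\nu(x)-\frac{2\Gamma(\nu+2)}{\sqrt\pi\,\Gamma\left(\nu+\frac32\right)}I_{\nu+1}(x)=\int_1^\infty\frac{\partial}{\partial u}\Big(\Gamma\big(2u+\nu+\tfrac32\big)I_{2u+\nu+1}(x)\Big)\left(\int_0^{[u]}\mathfrak d_s\left(\frac{\beta(s)}{\Gamma\left(2s+\nu+\frac32\right)}\right)\mathrm ds\right)\mathrm du,$$ where $$\beta(s)=-\frac{e^{\mathrm i\pi s}(2s+\nu+1)\Gamma(s+\nu+1)}{\sqrt\pi\,\Gamma\left(\nu+\frac12\right)\Gamma(s+1)\left(s+\frac12\right)\left(s+\nu+\frac12\right)}.$$
   Context: $I_\nu(x)=\sum_{n\ge0}\frac{(x/2)^{2n+\nu}}{\Gamma(n+\nu+1)\,n!}$ is the modified Bessel function of the first kind and $\mathbf L_\nu(x)=\sum_{n\ge0}\frac{(x/2)^{2n+\nu+1}}{\Gamma(n+\frac32)\Gamma(n+\nu+\frac32)}$ is the modified Struve function. $[x]$ and $\{x\}=x-[x]$ denote the integer and fractional part of a real number $x$. The operator $\mathfrak d_s$ is $\mathfrak d_s=1+\{s\}\frac{\mathrm d}{\mathrm ds}$, i.e. $\mathfrak d_s f(s)=f(s)+\{s\}f'(s)$. *)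

theory Defs
  imports "HOL-Analysis.Analysis"
begin

(* Both functions are meant for x > 0, where (x/2) powr a is the usual real power.
   Reciprocals of Gamma at its poles are 0 here, as is the usual convention, because
   Gamma is 0 at its poles and division by 0 gives 0. *)

definition modified_Bessel_I :: "real \<Rightarrow> real \<Rightarrow> real" where
  "modified_Bessel_I \<nu> x =
     (\<Sum>n. (x / 2) powr (2 * real n + \<nu>) / (Gamma (real n + \<nu> + 1) * fact n))"

definition modified_Struve_L :: "real \<Rightarrow> real \<Rightarrow> real" where
  "modified_Struve_L \<nu> x =
     (\<Sum>n. (x / 2) powr (2 * real n + \<nu> + 1) /
          (Gamma (real n + 3 / 2) * Gamma (real n + \<nu> + 3 / 2)))"

definition frac_diff_op :: "(real \<Rightarrow> complex) \<Rightarrow> real \<Rightarrow> complex" where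
  "frac_diff_op f s = f s + frac s *\<^sub>R vector_derivative f (at s)"

definition struve_beta :: "real \<Rightarrow> real \<Rightarrow> complex" where
  "struve_beta \<nu> s =
     - (exp (\<i> * of_real pi * of_real s) *
        of_real ((2 * s + \<nu> + 1) * Gamma (s + \<nu> + 1))) /
       of_real (sqrt pi * Gamma (\<nu> + 1 / 2) * Gamma (s + 1) * (s + 1 / 2) * (s + \<nu> + 1 / 2))"

end

theory Submission
  imports Defs
begin

text \<open>
  On \<open>{k..k+1}\<close> the function \<open>a(s) + {s} a'(s)\<close> is the derivative of \<open>(s - k) a(s)\<close>, so the inner integral is
  \<open>a(1) + \<dots> + a([u])\<close>. Writing \<open>F(u) = \<Gamma>(2u + \<nu> + 3/2) I\<^bsub>2u+\<nu>+1\<^esub>(x)\<close>, which decreases to 0, Abel summation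
  turns the outer integral into \<open>- \<Sum>\<^sub>n\<^sub>\<ge>\<^sub>1 \<beta>(n) I\<^bsub>2n+\<nu>+1\<^esub>(x)\<close>. It remains to prove the Neumann series
  \<open>L\<^sub>\<nu>(x) = - \<Sum>\<^sub>n\<^sub>\<ge>\<^sub>0 \<beta>(n) I\<^bsub>2n+\<nu>+1\<^esub>(x)\<close>, whose term \<open>n = 0\<close> is the one subtracted on the left. Comparing powers
  of \<open>x\<close>, this is the partial fraction expansion in \<open>t\<close> of \<open>\<Prod>\<^sub>j\<^sub>\<le>\<^sub>m 1 / (j (j + a) + t)\<close> at \<open>t = b (a - b)\<close>,
  where \<open>j (j + a) + t = (j + b) (j + a - b)\<close>, for \<open>a = \<nu> + 1\<close> and \<open>b = 1/2\<close>.
\<close>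

section \<open>Partial fractions and the finite coefficient identity\<close>

text \<open>Induction on the set of nodes: the new factor \<open>1 / (y i + t)\<close> is split
  against every old simple fraction, and what accumulates at the new pole is the old product
  evaluated there.\<close>

lemma partial_fraction_prod:
  fixes y :: "'a \<Rightarrow> 'b::field"
  assumes "finite A" "A \<noteq> {}" "inj_on y A" "\<And>j. j \<in> A \<Longrightarrow> y j + t \<noteq> 0"
  shows "(\<Prod>j\<in>A. 1 / (y j + t)) = (\<Sum>k\<in>A. (\<Prod>j\<in>A - {k}. 1 / (y j - y k)) / (y k + t))"
  using assms
proof (induction A arbitrary: t rule: finite_ne_induct)
  case (singleton i)
  then show ?case by simp
next
  case (insert i A)
  define w where "w k = (\<Prod>j\<in>A - {k}. 1 / (y j - y k))" for k
  have ne: "y k \<noteq> y i" if "k \<in> A" for k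
    using insert.prems(1) insert.hyps that by (auto simp: inj_on_def)
  have IH: "(\<Prod>j\<in>A. 1 / (y j + s)) = (\<Sum>k\<in>A. w k / (y k + s))" if "\<And>j. j \<in> A \<Longrightarrow> y j + s \<noteq> 0" for s
    unfolding w_def using insert.prems(1) that by (intro insert.IH) auto
  have "(\<Prod>j\<in>insert i A. 1 / (y j + t)) = 1 / (y i + t) * (\<Sum>k\<in>A. w k / (y k + t))"
    using insert.hyps insert.prems(2) IH[of t] by simp
  also have "\<dots> = (\<Sum>k\<in>A. 1 / (y i - y k) * w k / (y k + t) + w k / (y k + - y i) / (y i + t))"
    unfolding sum_distrib_left
  proof (intro sum.cong refl)
    fix k assume k: "k \<in> A"
    have "1 / (y i + t) * (1 / (y k + t)) = 1 / (y i - y k) / (y k + t) + 1 / (y k - y i) / (y i + t)"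
      using insert.prems(2)[of i] insert.prems(2)[of k] k ne[OF k] by (simp add: divide_simps) algebra
    then have "w k * (1 / (y i + t) * (1 / (y k + t))) =
        w k * (1 / (y i - y k) / (y k + t) + 1 / (y k - y i) / (y i + t))" by simp
    then show "1 / (y i + t) * (w k / (y k + t)) =
        1 / (y i - y k) * w k / (y k + t) + w k / (y k + - y i) / (y i + t)"
      by (simp add: algebra_simps)
  qed
  \<comment> \<open>the second part is the induction hypothesis at \<open>t = - y i\<close>\<close>
  also have "\<dots> = (\<Sum>k\<in>A. 1 / (y i - y k) * w k / (y k + t)) + (\<Prod>j\<in>A. 1 / (y j - y i)) / (y i + t)"
    using IH[of "- y i"] ne by (simp add: sum.distrib sum_divide_distrib)
  also have "(\<Sum>k\<in>A. 1 / (y i - y k) * w k / (y k + t)) =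
      (\<Sum>k\<in>A. (\<Prod>j\<in>insert i A - {k}. 1 / (y j - y k)) / (y k + t))"
  proof (intro sum.cong refl)
    fix k assume k: "k \<in> A"
    then have "insert i A - {k} = insert i (A - {k})" using insert.hyps by auto
    then show "1 / (y i - y k) * w k / (y k + t) = (\<Prod>j\<in>insert i A - {k}. 1 / (y j - y k)) / (y k + t)"
      using insert.hyps unfolding w_def by simp
  qed
  finally show ?case using insert.hyps by simp
qed

lemma Gamma_add_nat_real:
  fixes z :: real
  assumes "z > 0"
  shows "Gamma (z + real n) = pochhammer z n * Gamma z"
  using assms pochhammer_Gamma[of z n] Gamma_real_pos[of z]
  by (auto simp: field_simps nonpos_Ints_def simp del: Gamma_real_pos)

text \<open>The indices below \<open>k\<close> give the sign and \<open>fact k\<close>, those above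
  give \<open>fact (m - k)\<close>.\<close>

lemma prod_nat_diff_except:
  assumes "k \<le> m"
  shows "(\<Prod>j\<in>{..m} - {k}. real j - real k) = (-1) ^ k * fact k * fact (m - k)"
proof -
  have "{..m} - {k} = {..<k} \<union> {k<..m}" using assms by auto
  then have "(\<Prod>j\<in>{..m} - {k}. real j - real k) =
      (\<Prod>j<k. real j - real k) * (\<Prod>j\<in>{k<..m}. real j - real k)"
    by (simp add: prod.union_disjoint Int_def)
  also have "(\<Prod>j<k. real j - real k) = (\<Prod>j<k. - real (k - j))"
    by (intro prod.cong) auto
  also have "\<dots> = (-1) ^ k * (\<Prod>j<k. real (k - j))"
    by (subst prod_uminus) simp
  also have "(\<Prod>j<k. real (k - j)) = fact k"
    unfolding fact_prod_rev of_nat_prod by (simp add: atLeast0LessThan)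
  also have "(\<Prod>j\<in>{k<..m}. real j - real k) = (\<Prod>i\<in>{1..m-k}. real i)"
    using assms by (intro prod.reindex_bij_witness[of _ "\<lambda>i. i + k" "\<lambda>j. j - k"]) auto
  also have "\<dots> = fact (m - k)" by (simp add: fact_prod)
  finally show ?thesis by simp
qed

text \<open>Partial fractions at the nodes \<open>y j = j * (j + a)\<close>. The factorization
  \<open>y j - y k = (j - k) * (k + a + j)\<close> makes the nodes distinct and turns the residues
  into factorials and Gamma values; the undivided product gives the right-hand side.\<close>

lemma Neumann_coefficient_sum:
  fixes a b :: real
  assumes "0 < b" "b < a"
  shows "(\<Sum>k\<le>m. (-1) ^ k * (2 * real k + a) * Gamma (real k + a) /
      (fact k * fact (m - k) * Gamma (real m + real k + a + 1) * (real k + b) * (real k + a - b))) =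
    Gamma b * Gamma (a - b) / (Gamma (real m + 1 + b) * Gamma (real m + 1 + a - b))"
proof -
  define y where "y j = real j * (real j + a)" for j :: nat
  define t where "t = b * (a - b)"
  have yt: "y j + t = (real j + b) * (real j + a - b)" for j
    by (simp add: y_def t_def algebra_simps)
  have yd: "y j - y k = (real j - real k) * (real k + a + real j)" for j k
    by (simp add: y_def algebra_simps)
  have inj: "inj_on y {..m}"
  proof (rule inj_onI)
    fix j k assume "y j = y k"
    then have "(real j - real k) * (real k + a + real j) = 0" using yd[of j k] by simp
    moreover have "real k + a + real j > 0" using assms by simp
    ultimately show "j = k" by simp
  qed
  have pf: "(\<Prod>j\<le>m. 1 / (y j + t)) = (\<Sum>k\<le>m. (\<Prod>j\<in>{..m} - {k}. 1 / (y j - y k)) / (y k + t))"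
    using assms by (intro partial_fraction_prod inj) (auto simp: yt)
  have poch: "(\<Prod>j\<le>m. real j + c) = Gamma (real m + 1 + c) / Gamma c" if "c > 0" for c :: real
    using that Gamma_add_nat_real[of c "Suc m"] Gamma_real_pos[of c, THEN less_imp_neq]
    by (simp add: pochhammer_prod atMost_atLeast0 atLeastLessThanSuc_atLeastAtMost field_simps)
  have "(\<Prod>j\<le>m. 1 / (y j + t)) = 1 / ((\<Prod>j\<le>m. real j + b) * (\<Prod>j\<le>m. real j + (a - b)))"
    by (simp add: yt prod_dividef prod.distrib add_diff_eq)
  also have "\<dots> = Gamma b * Gamma (a - b) / (Gamma (real m + 1 + b) * Gamma (real m + 1 + a - b))"
    using poch[of b] poch[of "a - b"] assms by (simp del: of_nat_Suc) (simp add: add_diff_eq)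
  finally have lhs: "(\<Prod>j\<le>m. 1 / (y j + t)) = Gamma b * Gamma (a - b) / (Gamma (real m + 1 + b) * Gamma (real m + 1 + a - b))" .
  have "(\<Prod>j\<in>{..m} - {k}. 1 / (y j - y k)) / (y k + t) =
      (-1) ^ k * (2 * real k + a) * Gamma (real k + a) /
      (fact k * fact (m - k) * Gamma (real m + real k + a + 1) * (real k + b) * (real k + a - b))" if "k \<le> m" for k
  proof -
    \<comment> \<open>The omitted factor \<open>j = k\<close> equals \<open>2 * real k + a\<close>.
      Dividing it out of the full product is what brings this factor into the numerator of the
      summand.\<close>
    have "(\<Prod>j\<le>m. real j + (real k + a)) = (real k + (real k + a)) * (\<Prod>j\<in>{..m} - {k}. real j + (real k + a))"
      using that by (intro prod.remove) auto
    moreover have "real k + (real k + a) \<noteq> 0" using assms by simp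
    ultimately have P: "(\<Prod>j\<in>{..m} - {k}. real j + (real k + a)) =
        Gamma (real m + real k + a + 1) / (Gamma (real k + a) * (2 * real k + a))"
      using assms poch[of "real k + a"] Gamma_real_pos[of "real k + a"]
      by (simp add: eq_divide_eq mult_ac add_ac less_imp_neq[symmetric] del: Gamma_real_pos)
    have sign: "A / ((-1) ^ k * B) = (-1) ^ k * A / B" for A B :: real
      by (cases "even k") auto
    have "(\<Prod>j\<in>{..m} - {k}. 1 / (y j - y k)) =
        1 / ((\<Prod>j\<in>{..m} - {k}. real j - real k) * (\<Prod>j\<in>{..m} - {k}. real j + (real k + a)))"
      by (simp add: yd prod_dividef prod.distrib add_ac)
    also have "\<dots> = (2 * real k + a) * Gamma (real k + a) / ((-1) ^ k * (fact k * fact (m - k) * Gamma (real m + real k + a + 1)))"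
      unfolding P prod_nat_diff_except[OF that] by (simp add: mult.assoc mult.commute)
    also have "\<dots> = (-1) ^ k * ((2 * real k + a) * Gamma (real k + a)) / (fact k * fact (m - k) * Gamma (real m + real k + a + 1))"
      by (rule sign)
    finally show ?thesis by (simp only: yt divide_divide_eq_left mult.assoc add_diff_eq)
  qed
  then show ?thesis unfolding lhs[symmetric] pf by (intro sum.cong) auto
qed

section \<open>The inner integral and Abel summation on the half-line\<close>

text \<open>On a unit interval the primitive \<open>(s - real n) *\<^sub>R f s\<close> vanishes at
  the left end and equals \<open>f\<close> at the right end, so every interval contributes one value
  of \<open>f\<close>.\<close>

lemma has_integral_frac_diff_op:
  fixes f :: "real \<Rightarrow> complex"
  assumes "\<And>s. s \<ge> 0 \<Longrightarrow> f differentiable (at s)"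
  shows "(frac_diff_op f has_integral (\<Sum>k=1..n. f (real k))) {0..real n}"
proof (induction n)
  case 0
  then show ?case by (simp add: has_integral_refl)
next
  case (Suc n)
  have "((\<lambda>s. f s + (s - real n) *\<^sub>R vector_derivative f (at s)) has_integral
      ((real (Suc n) - real n) *\<^sub>R f (real (Suc n)) - (real n - real n) *\<^sub>R f (real n))) {real n..real (Suc n)}"
  proof (intro fundamental_theorem_of_calculus)
    fix s assume s: "s \<in> {real n..real (Suc n)}"
    then have "(f has_vector_derivative vector_derivative f (at s)) (at s within {real n..real (Suc n)})"
      using assms[of s] by (simp add: vector_derivative_works has_vector_derivative_at_within)
    then show "((\<lambda>s. (s - real n) *\<^sub>R f s) has_vector_derivative
        f s + (s - real n) *\<^sub>R vector_derivative f (at s)) (at s within {real n..real (Suc n)})"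
      by (auto intro!: derivative_eq_intros)
  qed simp
  then have "((\<lambda>s. f s + (s - real n) *\<^sub>R vector_derivative f (at s)) has_integral f (real (Suc n)))
      {real n..real (Suc n)}" by simp
  \<comment> \<open>At the right end point \<open>frac\<close> jumps back to 0, so the two
    integrands may differ there; one point does not change the integral.\<close>
  then have "(frac_diff_op f has_integral f (real (Suc n))) {real n..real (Suc n)}"
  proof (rule has_integral_spike_finite[of "{real (Suc n)}", rotated 2])
    fix s assume s: "s \<in> {real n..real (Suc n)} - {real (Suc n)}"
    then have "\<lfloor>s\<rfloor> = int n" by (intro floor_unique) auto
    then show "frac_diff_op f s = f s + (s - real n) *\<^sub>R vector_derivative f (at s)"
      by (simp add: frac_diff_op_def frac_def)
  qed auto
  from has_integral_combine[OF _ _ Suc.IH this] show ?case by simp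
qed

text \<open>Summation by parts up to an integer, then dominated convergence. The sign of
  \<open>F'\<close> and the limit of \<open>F\<close> make \<open>- F'\<close> integrable, and the
  bounded partial sums turn \<open>C * - F' u\<close> into a majorant of the integrand.\<close>

lemma has_integral_Abel_summation_to_inf:
  fixes F F' :: "real \<Rightarrow> real" and c :: "nat \<Rightarrow> real"
  assumes deriv: "\<And>u. u \<ge> 1 \<Longrightarrow> (F has_real_derivative F' u) (at u)"
    and nonpos: "\<And>u. u \<ge> 1 \<Longrightarrow> F' u \<le> 0"
    and lim: "(F \<longlongrightarrow> 0) at_top"
    and bound: "\<And>n. \<bar>\<Sum>k=1..n. c k\<bar> \<le> C"
    and sums: "(\<lambda>n. c (Suc n) * F (real (Suc n))) sums S"
  shows "((\<lambda>u. F' u * (\<Sum>k=1..nat \<lfloor>u\<rfloor>. c k)) has_integral - S) {1..}"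
proof -
  define A where "A n = (\<Sum>k=1..n. c k)" for n
  define g where "g u = F' u * A (nat \<lfloor>u\<rfloor>)" for u
  have FTC: "(F' has_integral F q - F p) {p..q}" if "1 \<le> p" "p \<le> q" for p q
    using that deriv by (intro fundamental_theorem_of_calculus)
      (auto simp flip: has_real_derivative_iff_has_vector_derivative intro: has_field_derivative_at_within)
  \<comment> \<open>The partial sum is constant on each unit interval up to its right end point. For
    \<open>n = 0\<close> the interval is degenerate and the two terms cancel.\<close>
  have g_int: "(g has_integral (A (Suc n) * F (Suc n) - (\<Sum>k<Suc n. c (Suc k) * F (Suc k)))) {1..real (Suc n)}" for n
  proof (induction n)
    case 0
    then show ?case by (simp add: has_integral_refl A_def)
  next
    case (Suc n)
    have "((\<lambda>u. F' u * A (Suc n)) has_integral (F (Suc (Suc n)) - F (Suc n)) * A (Suc n)) {real (Suc n)..real (Suc (Suc n))}"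
      by (intro has_integral_mult_left FTC) auto
    then have "(g has_integral (F (Suc (Suc n)) - F (Suc n)) * A (Suc n)) {real (Suc n)..real (Suc (Suc n))}"
    proof (rule has_integral_spike_finite[of "{real (Suc (Suc n))}", rotated 2])
      fix u assume u: "u \<in> {real (Suc n)..real (Suc (Suc n))} - {real (Suc (Suc n))}"
      then have "\<lfloor>u\<rfloor> = int (Suc n)" by (intro floor_unique) auto
      then show "g u = F' u * A (Suc n)" by (simp add: g_def del: of_nat_Suc)
    qed auto
    from has_integral_combine[OF _ _ Suc.IH this] show ?case
      by (simp add: A_def algebra_simps)
  qed
  \<comment> \<open>As \<open>- F'\<close> is nonnegative, convergence of its integrals over
    \<open>{1..y}\<close> already yields integrability on the half-line.\<close>
  have F'_int: "((\<lambda>u. - F' u) has_integral F 1) {1..}"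
  proof (rule has_integral_to_inf)
    have I: "((\<lambda>u. - F' u) has_integral F 1 - F y) {1..y}" if "y \<ge> 1" for y
      using has_integral_neg[OF FTC[of 1 y]] that by simp
    show "(\<lambda>u. - F' u) integrable_on {1..y}" for y
      using I[of y] by (cases "y \<ge> 1") (auto simp: integrable_on_def)
    have "((\<lambda>y. F 1 - F y) \<longlongrightarrow> F 1 - 0) at_top" by (intro tendsto_intros lim)
    moreover have "eventually (\<lambda>y. F 1 - F y = integral {1..y} (\<lambda>u. - F' u)) at_top"
      using eventually_ge_at_top[of 1] by eventually_elim (metis I integral_unique)
    ultimately show "((\<lambda>y. integral {1..y} (\<lambda>u. - F' u)) \<longlongrightarrow> F 1) at_top"
      by (simp add: tendsto_cong)
  qed (use nonpos in auto)
  \<comment> \<open>Truncations of \<open>g\<close>; at a fixed \<open>u\<close> they agree with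
    \<open>g u\<close> from some \<open>n\<close> on, which gives the pointwise limit.\<close>
  define f where "f n u = (if u \<in> {1..real (Suc n)} then g u else 0)" for n u
  have f_int: "(f n has_integral (A (Suc n) * F (Suc n) - (\<Sum>k<Suc n. c (Suc k) * F (Suc k)))) {1..}" for n
    unfolding f_def using g_int[of n] by (subst has_integral_restrict) auto
  have "C \<ge> 0" using bound[of 0] by simp
  have f_le: "norm (f n u) \<le> C * - F' u" if "u \<in> {1..}" for n u
  proof -
    have "\<bar>F' u\<bar> * \<bar>A (nat \<lfloor>u\<rfloor>)\<bar> \<le> \<bar>F' u\<bar> * C"
      using bound by (intro mult_left_mono) (auto simp: A_def)
    then show ?thesis
      using nonpos[of u] that \<open>C \<ge> 0\<close>
      by (auto simp: f_def g_def abs_mult mult.commute mult_nonneg_nonpos)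
  qed
  have f_lim: "(\<lambda>n. f n u) \<longlonglongrightarrow> g u" if "u \<in> {1..}" for u
  proof -
    have "eventually (\<lambda>n. f n u = g u) sequentially"
      using eventually_ge_at_top[of "nat \<lceil>u\<rceil>"] by eventually_elim (use that in \<open>auto simp: f_def; linarith\<close>)
    then show ?thesis by (rule tendsto_eventually)
  qed
  have f_integrable: "f n integrable_on {1..}" for n using f_int by (auto simp: integrable_on_def)
  have h_integrable: "(\<lambda>u. C * - F' u) integrable_on {1..}"
    using has_integral_mult_right[OF F'_int, of C] by (auto simp: integrable_on_def)
  note dc = dominated_convergence[OF f_integrable h_integrable f_le f_lim]
  have "(\<lambda>n. A (Suc n) * F (Suc n)) \<longlonglongrightarrow> 0"
  proof (rule Lim_null_comparison)
    show "eventually (\<lambda>n. norm (A (Suc n) * F (real (Suc n))) \<le> C * \<bar>F (real (Suc n))\<bar>) sequentially"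
      using bound[of "Suc _"] unfolding A_def
      by (intro always_eventually allI) (simp only: real_norm_def abs_mult mult_right_mono abs_ge_zero)
    have "(\<lambda>n. F (real (Suc n))) \<longlonglongrightarrow> 0"
      by (rule filterlim_compose[OF lim])
         (rule filterlim_compose[OF filterlim_real_sequentially filterlim_Suc])
    then show "(\<lambda>n. C * \<bar>F (real (Suc n))\<bar>) \<longlonglongrightarrow> 0"
      by (intro tendsto_mult_right_zero tendsto_rabs_zero)
  qed
  moreover have "(\<lambda>n. \<Sum>k<Suc n. c (Suc k) * F (real (Suc k))) \<longlonglongrightarrow> S"
    using sums unfolding sums_def by (rule LIMSEQ_Suc)
  ultimately have "(\<lambda>n. integral {1..} (f n)) \<longlonglongrightarrow> 0 - S"
    unfolding f_int[THEN integral_unique] by (rule tendsto_diff)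
  with dc(2) have "integral {1..} g = 0 - S" by (rule LIMSEQ_unique)
  with integrable_integral[OF dc(1)] have "(g has_integral - S) {1..}" by simp
  then show ?thesis unfolding g_def A_def .
qed

section \<open>Estimates for Pochhammer symbols and Gamma quotients\<close>

lemma pochhammer_ge_1:
  fixes a :: real
  assumes "a \<ge> 1"
  shows "pochhammer a n \<ge> 1"
proof (induction n)
  case (Suc n)
  have "1 * 1 \<le> pochhammer a n * (a + real n)"
    using Suc assms by (intro mult_mono) auto
  then show ?case by (simp add: pochhammer_Suc)
qed simp

lemma Gamma_real_nonzero: "x > (0::real) \<Longrightarrow> Gamma x \<noteq> 0"
  using Gamma_real_pos[of x] by linarith

lemma Gamma_affine_has_real_derivative:
  fixes p q s :: real
  assumes "p * s + q > 0"
  shows "((\<lambda>s. Gamma (p * s + q)) has_real_derivative p * (Gamma (p * s + q) * Digamma (p * s + q))) (at s)"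
  using assms by (auto intro!: derivative_eq_intros simp: nonpos_Ints_def mult.commute)

text \<open>The logarithmic derivative in \<open>w\<close> is
  \<open>Digamma w - Digamma (w + s)\<close>, which is nonpositive because \<open>Digamma\<close>
  increases on the positive reals.\<close>

lemma Gamma_ratio_antimono:
  fixes s w w' :: real
  assumes "0 \<le> s" "0 < w" "w \<le> w'"
  shows "Gamma w' / Gamma (w' + s) \<le> Gamma w / Gamma (w + s)"
proof (rule DERIV_nonpos_imp_nonincreasing[OF assms(3)])
  fix y assume y: "w \<le> y" "y \<le> w'"
  have pos: "y > 0" "y + s > 0" using assms y by auto
  then have G: "Gamma y > 0" "Gamma (y + s) > 0" by simp_all
  have "((\<lambda>y. Gamma y / Gamma (y + s)) has_real_derivative
      (Gamma y * Digamma y * Gamma (y + s) - Gamma y * (Gamma (y + s) * Digamma (y + s)))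
        / (Gamma (y + s) * Gamma (y + s))) (at y)"
    using Gamma_affine_has_real_derivative[of 1 y 0] Gamma_affine_has_real_derivative[of 1 y s] pos
      Gamma_real_nonzero[of "y + s"]
    by (intro DERIV_divide) simp_all
  moreover have "(Gamma y * Digamma y * Gamma (y + s) - Gamma y * (Gamma (y + s) * Digamma (y + s)))
      = Gamma y * Gamma (y + s) * (Digamma y - Digamma (y + s))"
    by (simp add: algebra_simps)
  moreover have "\<dots> \<le> 0"
    using Digamma_real_mono[of y "y + s"] pos assms(1) G
    by (intro mult_nonneg_nonpos) auto
  ultimately show "\<exists>D. ((\<lambda>y. Gamma y / Gamma (y + s)) has_real_derivative D) (at y) \<and> D \<le> 0"
    using G by (metis divide_nonpos_pos mult_pos_pos)
qed

section \<open>The Bessel function as a function of its order\<close>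

text \<open>The hypergeometric series 0F1 with parameter \<open>w + 1\<close> at \<open>z\<close>.
  It is what remains of \<open>modified_Bessel_I w x\<close>, with \<open>z = (x / 2) ^ 2\<close>,
  after removing \<open>(x / 2) powr w / Gamma (w + 1)\<close>; for \<open>z\<close> and
  \<open>w\<close> nonnegative, no term increases with \<open>w\<close>.\<close>

definition bessel_kernel :: "real \<Rightarrow> real \<Rightarrow> real" where
  "bessel_kernel z w = (\<Sum>n. z ^ n / (fact n * pochhammer (w + 1) n))"

lemma summable_bessel_kernel:
  fixes z w :: real
  assumes "z \<ge> 0" "w \<ge> 0"
  shows "summable (\<lambda>n. z ^ n / (fact n * pochhammer (w + 1) n))"
proof (rule summable_comparison_test'[OF summable_exp[of z]])
  fix n
  have "z ^ n / fact n / pochhammer (w + 1) n \<le> z ^ n / fact n / 1"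
    using assms pochhammer_ge_1[of "w + 1" n] by (intro divide_left_mono) auto
  then show "norm (z ^ n / (fact n * pochhammer (w + 1) n)) \<le> inverse (fact n) * z ^ n"
    using assms pochhammer_ge_1[of "w + 1" n] by (simp add: field_simps)
qed

lemma bessel_kernel_antimono:
  assumes "z \<ge> 0" "0 \<le> w" "w \<le> w'"
  shows "bessel_kernel z w' \<le> bessel_kernel z w"
  unfolding bessel_kernel_def
proof (intro suminf_le summable_bessel_kernel)
  fix n
  have "pochhammer (w + 1) n \<le> pochhammer (w' + 1) n"
    unfolding pochhammer_prod using assms by (intro prod_mono) auto
  then show "z ^ n / (fact n * pochhammer (w' + 1) n) \<le> z ^ n / (fact n * pochhammer (w + 1) n)"
    using assms pochhammer_ge_1[of "w + 1" n] pochhammer_ge_1[of "w' + 1" n]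
    by (intro divide_left_mono mult_left_mono) (auto simp del: One_nat_def)
qed (use assms in auto)

lemma bessel_kernel_nonneg:
  assumes "z \<ge> 0" "w \<ge> 0"
  shows "bessel_kernel z w \<ge> 0"
  unfolding bessel_kernel_def using assms pochhammer_ge_1[of "w + 1"]
  by (intro suminf_nonneg summable_bessel_kernel divide_nonneg_nonneg mult_nonneg_nonneg)
     (auto intro: order_trans[OF zero_le_one])

text \<open>Prepares termwise differentiation in the order. All factors \<open>w + 1 + i\<close> are
  at least 1, so by the product rule each new factor raises the bound by at most 1. The bound is
  uniform in \<open>w\<close>.\<close>

lemma inverse_pochhammer_has_derivative:
  fixes w :: real
  assumes "w > 0"
  shows "\<exists>D. ((\<lambda>w. 1 / pochhammer (w + 1) n) has_real_derivative D) (at w) \<and> \<bar>D\<bar> \<le> real n"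
proof (induction n)
  case 0
  then show ?case by (auto intro!: exI[of _ 0])
next
  case (Suc n)
  then obtain D where D: "((\<lambda>w. 1 / pochhammer (w + 1) n) has_real_derivative D) (at w)" "\<bar>D\<bar> \<le> real n"
    by auto
  define q where "q = w + 1 + real n"
  have q: "q \<ge> 1" using assms by (simp add: q_def)
  define P where "P = 1 / pochhammer (w + 1) n"
  have P: "0 \<le> P" "P \<le> 1" using pochhammer_ge_1[of "w + 1" n] assms by (auto simp: P_def)
  have "((\<lambda>w. 1 / pochhammer (w + 1) n * (1 / (w + 1 + real n))) has_real_derivative
      D * (1 / q) + (- 1 / q ^ 2) * P) (at w)"
    unfolding P_def using q
    by (intro DERIV_cong[OF DERIV_mult[OF D(1), of _ "- 1 / q ^ 2"]])
       (auto intro!: derivative_eq_intros simp: q_def power2_eq_square)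
  moreover have "\<bar>D * (1 / q) + (- 1 / q ^ 2) * P\<bar> \<le> \<bar>D\<bar> * (1 / q) + 1 / q ^ 2 * P"
    using q P by (intro order_trans[OF abs_triangle_ineq]) (auto simp: abs_mult)
  moreover have "\<bar>D\<bar> * (1 / q) \<le> real n * 1" using D(2) q by (intro mult_mono) auto
  moreover have "1 / q ^ 2 * P \<le> 1 * 1" using P q by (intro mult_mono) auto
  ultimately show ?case by (intro exI[of _ "D * (1 / q) + (- 1 / q ^ 2) * P"]) (simp add: pochhammer_Suc)
qed

lemma bessel_kernel_differentiable:
  assumes "z \<ge> 0" "w > 0"
  shows "bessel_kernel z differentiable (at w)"
proof -
  define D where "D n w = (SOME D. ((\<lambda>w. 1 / pochhammer (w + 1) n) has_real_derivative D) (at w) \<and> \<bar>D\<bar> \<le> real n)"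
    for n and w :: real
  have D: "((\<lambda>w. 1 / pochhammer (w + 1) n) has_real_derivative D n w) (at w)" "\<bar>D n w\<bar> \<le> real n"
    if "w > 0" for n and w :: real
    using someI_ex[OF inverse_pochhammer_has_derivative[OF that, of n]] by (auto simp: D_def)
  have "(\<lambda>w. \<Sum>n. z ^ n / (fact n * pochhammer (w + 1) n)) differentiable (at w)"
  proof (rule differentiable_series'[of "{0<..}" _ "\<lambda>n w. z ^ n / fact n * D n w"])
    show "((\<lambda>w. z ^ n / (fact n * pochhammer (w + 1) n)) has_real_derivative z ^ n / fact n * D n y) (at y)"
      if "y \<in> {0<..}" for n y
      using DERIV_cmult[OF D(1)[of y n], of "z ^ n / fact n"] that by simp
    show "uniformly_convergent_on {0<..} (\<lambda>n w. \<Sum>i<n. z ^ i / fact i * D i w)"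
    \<comment> \<open>The derivative bound \<open>n\<close> is absorbed by
      \<open>n \<le> 2 ^ n\<close>, leaving the exponential series at \<open>2 * z\<close> as
      majorant.\<close>
    proof (rule Weierstrass_m_test'[where M = "\<lambda>n. inverse (fact n) * (2 * z) ^ n"])
      fix n and y :: real assume "y \<in> {0<..}"
      then have "\<bar>D n y\<bar> \<le> real n" using D(2) by auto
      also have "\<dots> \<le> 2 ^ n" using of_nat_mono[OF less_imp_le[OF less_exp[of n]], where 'a = real] by simp
      finally have "z ^ n / fact n * \<bar>D n y\<bar> \<le> z ^ n / fact n * 2 ^ n"
        using assms by (intro mult_left_mono) auto
      then show "norm (z ^ n / fact n * D n y) \<le> inverse (fact n) * (2 * z) ^ n"
        using assms by (simp add: abs_mult field_simps)
    qed (rule summable_exp)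
  qed (use assms summable_bessel_kernel in auto)
  then show ?thesis unfolding bessel_kernel_def[abs_def] .
qed

lemma powr_even_shift:
  fixes y w :: real
  assumes "y > 0"
  shows "y powr (2 * real n + w) = y powr w * (y ^ 2) ^ n"
proof -
  have "2 * real n + w = w + real (2 * n)" by simp
  then show ?thesis using assms by (simp only: powr_add powr_realpow power_mult)
qed

lemma Bessel_I_term_eq:
  fixes x w :: real
  assumes "x > 0" "w \<ge> 0"
  shows "(x / 2) powr (2 * real n + w) / (Gamma (real n + w + 1) * fact n) =
    (x / 2) powr w / Gamma (w + 1) * (((x / 2) ^ 2) ^ n / (fact n * pochhammer (w + 1) n))"
  using assms Gamma_add_nat_real[of "w + 1" n]
    Gamma_real_nonzero[of "w + 1"] pochhammer_pos[of "w + 1" n] powr_even_shift[of "x / 2" n w]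
  by (simp add: add_ac mult_ac)

lemma summable_Bessel_I:
  assumes "x > 0" "w \<ge> 0"
  shows "summable (\<lambda>n. (x / 2) powr (2 * real n + w) / (Gamma (real n + w + 1) * fact n))"
  unfolding Bessel_I_term_eq[OF assms] by (intro summable_mult summable_bessel_kernel) (use assms in auto)

lemma modified_Bessel_I_eq_kernel:
  assumes "x > 0" "w \<ge> 0"
  shows "modified_Bessel_I w x = (x / 2) powr w / Gamma (w + 1) * bessel_kernel ((x / 2) ^ 2) w"
  unfolding modified_Bessel_I_def bessel_kernel_def Bessel_I_term_eq[OF assms]
  by (intro suminf_mult summable_bessel_kernel) (use assms in auto)

text \<open>Each of the three factors on the right is nonnegative and nonincreasing in
  \<open>w\<close>, the power because \<open>x \<le> 2\<close> wherever monotonicity is used. The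
  argument \<open>w + 1 / 2 + 1 / 2\<close> stays unsimplified to match
  \<open>Gamma_ratio_antimono\<close> with \<open>s = 1 / 2\<close>.\<close>

lemma Gamma_Bessel_I_eq:
  assumes "x > 0" "w \<ge> 0"
  shows "Gamma (w + 1 / 2) * modified_Bessel_I w x =
    Gamma (w + 1 / 2) / Gamma (w + 1 / 2 + 1 / 2) * (x / 2) powr w * bessel_kernel ((x / 2) ^ 2) w"
  by (simp add: modified_Bessel_I_eq_kernel[OF assms] add.commute mult_ac)

lemma Gamma_Bessel_I_differentiable:
  assumes "x > 0" "w > 0"
  shows "(\<lambda>w. Gamma (w + 1 / 2) * modified_Bessel_I w x) differentiable (at w)"
proof -
  have G: "(\<lambda>w. Gamma (w + c)) differentiable (at w)" if "c > 0" for c :: real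
    using Gamma_affine_has_real_derivative[of 1 w c] assms that by (auto simp: real_differentiable_def)
  have p: "(\<lambda>w. (x / 2) powr w) differentiable (at w)"
    unfolding real_differentiable_def using assms by (auto intro!: derivative_eq_intros)
  have nz: "Gamma (w + 1 / 2 + 1 / 2) \<noteq> 0" using assms by (intro Gamma_real_nonzero) simp
  have "(\<lambda>w. Gamma (w + 1 / 2) / Gamma (w + 1 / 2 + 1 / 2) * (x / 2) powr w * bessel_kernel ((x / 2) ^ 2) w)
      differentiable (at w)"
    using G[of "1 / 2"] G[of 1] nz
    by (intro differentiable_mult differentiable_divide p bessel_kernel_differentiable) (use assms in \<open>auto simp: add.commute\<close>)
  \<comment> \<open>The factorization is established for nonnegative orders, so the derivative is
    transferred through a neighbourhood of \<open>w\<close> inside \<open>{0<..}\<close>.\<close>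
  moreover have "eventually (\<lambda>w. Gamma (w + 1 / 2) / Gamma (w + 1 / 2 + 1 / 2) * (x / 2) powr w * bessel_kernel ((x / 2) ^ 2) w
      = Gamma (w + 1 / 2) * modified_Bessel_I w x) (nhds w)"
    using eventually_nhds_in_open[of "{0<..}" w] assms
    by (auto elim!: eventually_mono simp: Gamma_Bessel_I_eq)
  ultimately show ?thesis
    unfolding real_differentiable_def by (simp only: DERIV_cong_ev[OF refl _ refl])
qed

lemma Gamma_Bessel_I_antimono:
  assumes "0 < x" "x \<le> 2" "0 < w" "w \<le> w'"
  shows "Gamma (w' + 1 / 2) * modified_Bessel_I w' x \<le> Gamma (w + 1 / 2) * modified_Bessel_I w x"
proof -
  have "(x / 2) powr w' \<le> (x / 2) powr w" using assms by (intro powr_mono') auto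
  then show ?thesis
    using assms Gamma_ratio_antimono[of "1 / 2" "w + 1 / 2" "w' + 1 / 2"]
    by (simp only: Gamma_Bessel_I_eq less_imp_le)
       (intro mult_mono bessel_kernel_antimono bessel_kernel_nonneg mult_nonneg_nonneg divide_nonneg_nonneg; simp)
qed

text \<open>For \<open>w \<ge> 1\<close> the Gamma quotient and the kernel are bounded by their
  values at \<open>w = 1\<close>, whose product is \<open>C\<close>; the decay comes from
  \<open>(x / 2) powr w\<close> with \<open>x / 2 < 1\<close>.\<close>

lemma Gamma_Bessel_I_tendsto_0:
  assumes "0 < x" "x < 2"
  shows "((\<lambda>w. Gamma (w + 1 / 2) * modified_Bessel_I w x) \<longlongrightarrow> 0) at_top"
proof (rule Lim_null_comparison)
  define C where "C = Gamma (1 + 1 / 2) / Gamma (1 + 1 / 2 + 1 / 2) * bessel_kernel ((x / 2) ^ 2) 1"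
  show "eventually (\<lambda>w. norm (Gamma (w + 1 / 2) * modified_Bessel_I w x) \<le> C * (x / 2) powr w) at_top"
    using eventually_ge_at_top[of 1]
  proof eventually_elim
    fix w :: real assume w: "w \<ge> 1"
    let ?G = "Gamma (w + 1 / 2) / Gamma (w + 1 / 2 + 1 / 2)" and ?K = "bessel_kernel ((x / 2) ^ 2) w"
    have nn: "?G \<ge> 0" "?K \<ge> 0" using w assms by (auto intro!: bessel_kernel_nonneg divide_nonneg_nonneg)
    have "?G * ?K \<le> C"
      unfolding C_def using w assms nn
      by (intro mult_mono bessel_kernel_antimono Gamma_ratio_antimono) auto
    then have "?G * ?K * (x / 2) powr w \<le> C * (x / 2) powr w" by (intro mult_right_mono) auto
    moreover have "Gamma (w + 1 / 2) * modified_Bessel_I w x = ?G * ?K * (x / 2) powr w"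
      using w assms Gamma_Bessel_I_eq[of x w] by (simp only: mult_ac)
    ultimately show "norm (Gamma (w + 1 / 2) * modified_Bessel_I w x) \<le> C * (x / 2) powr w"
      using nn by (simp only: real_norm_def abs_of_nonneg mult_nonneg_nonneg powr_ge_zero)
  qed
  have "((\<lambda>w. (x / 2) powr w) \<longlongrightarrow> 0) at_top"
  proof -
    have "filterlim (\<lambda>w. ln (x / 2) * w) at_bot at_top"
      using assms by (intro filterlim_tendsto_neg_mult_at_bot[OF tendsto_const] filterlim_ident) auto
    then have "((\<lambda>w. exp (ln (x / 2) * w)) \<longlongrightarrow> 0) at_top"
      by (rule filterlim_compose[OF exp_at_bot])
    then show ?thesis using assms by (simp add: powr_def mult.commute)
  qed
  then show "((\<lambda>w. C * (x / 2) powr w) \<longlongrightarrow> 0) at_top" by (rule tendsto_mult_right_zero)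
qed

section \<open>The Neumann series of the Struve function\<close>

text \<open>The values of \<open>- struve_beta \<nu>\<close> at the natural numbers, real because
  the exponential factor reduces there to a sign.\<close>

definition Neumann_coefficient :: "real \<Rightarrow> nat \<Rightarrow> real" where
  "Neumann_coefficient \<nu> k = (-1) ^ k * (2 * real k + \<nu> + 1) * Gamma (real k + \<nu> + 1) /
     (sqrt pi * Gamma (\<nu> + 1 / 2) * fact k * (real k + 1 / 2) * (real k + \<nu> + 1 / 2))"

text \<open>The rational factor equals \<open>1 / (k + 1 / 2) + 1 / (k + \<nu> + 1 / 2)\<close>, and
  both fractions are at most 2; hence the constant 4.\<close>

lemma abs_Neumann_coefficient_le:
  assumes "\<nu> > 0"
  shows "\<bar>Neumann_coefficient \<nu> k\<bar> \<le> 4 / (sqrt pi * Gamma (\<nu> + 1 / 2)) * (Gamma (real k + \<nu> + 1) / fact k)"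
proof -
  define A where "A = Gamma (real k + \<nu> + 1) / (sqrt pi * Gamma (\<nu> + 1 / 2) * fact k)"
  have A: "A \<ge> 0" using assms by (simp add: A_def)
  have "\<bar>Neumann_coefficient \<nu> k\<bar> = A * ((2 * real k + \<nu> + 1) / ((real k + 1 / 2) * (real k + \<nu> + 1 / 2)))"
    using assms by (simp add: Neumann_coefficient_def A_def abs_mult power_abs mult_ac)
  also have "(2 * real k + \<nu> + 1) / ((real k + 1 / 2) * (real k + \<nu> + 1 / 2)) =
      1 / (real k + 1 / 2) + 1 / (real k + \<nu> + 1 / 2)"
    using assms by (simp add: field_simps)
  also have "\<dots> \<le> 2 + 2"
    using assms by (intro add_mono) (auto simp: field_simps)
  finally have "\<bar>Neumann_coefficient \<nu> k\<bar> \<le> A * 4"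
    using A by (simp add: mult_left_mono)
  then show ?thesis by (simp add: A_def mult_ac)
qed

text \<open>Majorant for the double series. The Gamma value in the denominator is
  \<open>Gamma (k + \<nu> + 1)\<close> times a Pochhammer symbol of length \<open>j + k + 1\<close>,
  which is at least 1, so it absorbs the Gamma value of the coefficient.\<close>

lemma Neumann_term_bound:
  assumes "\<nu> > 0"
  shows "\<bar>Neumann_coefficient \<nu> k / (Gamma (real j + (2 * real k + \<nu> + 1) + 1) * fact j)\<bar>
    \<le> 4 / (sqrt pi * Gamma (\<nu> + 1 / 2)) * (1 / fact k * (1 / fact j))"
proof -
  define G H where "G = Gamma (real k + \<nu> + 1)" and "H = Gamma (real j + (2 * real k + \<nu> + 1) + 1)"
  define C where "C = 4 / (sqrt pi * Gamma (\<nu> + 1 / 2))"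
  have G: "G > 0" and C: "C \<ge> 0" using assms by (auto simp: G_def C_def)
  have "H = pochhammer (real k + \<nu> + 1) (j + k + 1) * G"
    using Gamma_add_nat_real[of "real k + \<nu> + 1" "j + k + 1"] assms by (simp add: G_def H_def add_ac)
  moreover have "pochhammer (real k + \<nu> + 1) (j + k + 1) \<ge> 1"
    using assms by (intro pochhammer_ge_1) auto
  ultimately have GH: "G \<le> H" using G by simp
  have "\<bar>Neumann_coefficient \<nu> k / (H * fact j)\<bar> = \<bar>Neumann_coefficient \<nu> k\<bar> / (H * fact j)"
    using G GH by simp
  also have "\<dots> \<le> C * (G / fact k) / (H * fact j)"
    using G GH abs_Neumann_coefficient_le[OF assms, of k] unfolding G_def C_def
    by (intro divide_right_mono) auto
  also have "\<dots> = G / H * (C * (1 / fact k * (1 / fact j)))"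
    by (simp add: mult_ac)
  also have "\<dots> \<le> 1 * (C * (1 / fact k * (1 / fact j)))"
    using G GH C by (intro mult_right_mono) auto
  finally show ?thesis by (simp only: H_def C_def mult_1)
qed

lemma summable_on_exp_product:
  fixes z :: real
  assumes "z \<ge> 0"
  shows "(\<lambda>(k, j). z ^ k / fact k * (z ^ j / fact j)) summable_on (UNIV \<times> UNIV :: (nat \<times> nat) set)"
proof (rule summable_on_SigmaI)
  have "(\<lambda>n. z ^ n / fact n) sums exp z"
    using exp_converges[of z] by (simp add: divide_inverse mult.commute)
  then have hs: "((\<lambda>n. z ^ n / fact n) has_sum exp z) UNIV"
    using assms by (intro norm_summable_imp_has_sum) (auto simp: sums_iff)
  show "((\<lambda>j. case (k, j) of (k, j) \<Rightarrow> z ^ k / fact k * (z ^ j / fact j)) has_sum z ^ k / fact k * exp z) UNIV" for k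
    using has_sum_cmult_right[OF hs, of "z ^ k / fact k"] by simp
  show "(\<lambda>k. z ^ k / fact k * exp z) summable_on UNIV"
    using has_sum_cmult_left[OF hs] unfolding summable_on_def by blast
qed (use assms in auto)

text \<open>Expanding each Bessel function gives an absolutely summable double series. Its rows sum
  to the terms of the Neumann series, its diagonals to the terms of the Struve series.\<close>

theorem Neumann_series_Struve_L:
  assumes "\<nu> > 0" "x > 0"
  shows "(\<lambda>k. Neumann_coefficient \<nu> k * modified_Bessel_I (2 * real k + \<nu> + 1) x) sums modified_Struve_L \<nu> x"
proof -
  define z where "z = (x / 2) ^ 2"
  define C where "C = 4 / (sqrt pi * Gamma (\<nu> + 1 / 2))"
  define D where "D = (x / 2) powr (\<nu> + 1)"
  have z: "z \<ge> 0" and D: "D \<ge> 0" by (auto simp: z_def D_def)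
  define t where "t = (\<lambda>(k, j). Neumann_coefficient \<nu> k *
    ((x / 2) powr (2 * real j + (2 * real k + \<nu> + 1)) / (Gamma (real j + (2 * real k + \<nu> + 1) + 1) * fact j)))"
  have pw: "(x / 2) powr (2 * real j + (2 * real k + \<nu> + 1)) = D * z ^ (j + k)" for j k
    using powr_even_shift[of "x / 2" "j + k" "\<nu> + 1"] assms by (simp add: D_def z_def algebra_simps)
  have t_eq: "t (k, j) = D * z ^ (j + k) * (Neumann_coefficient \<nu> k / (Gamma (real j + (2 * real k + \<nu> + 1) + 1) * fact j))" for k j
    by (simp add: t_def pw)
  have "(\<lambda>p. norm (t p)) summable_on (UNIV \<times> UNIV)"
  proof (rule Infinite_Sum.abs_summable_on_comparison_test')
    show "(\<lambda>p. C * D * (case p of (k, j) \<Rightarrow> z ^ k / fact k * (z ^ j / fact j))) summable_on UNIV \<times> UNIV"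
      by (intro summable_on_cmult_right summable_on_exp_product z)
    fix p :: "nat \<times> nat"
    obtain k j where p: "p = (k, j)" by (cases p)
    have "norm (t p) = D * z ^ (j + k) * \<bar>Neumann_coefficient \<nu> k / (Gamma (real j + (2 * real k + \<nu> + 1) + 1) * fact j)\<bar>"
      using z D unfolding p t_eq real_norm_def abs_mult by simp
    also have "\<dots> \<le> D * z ^ (j + k) * (C * (1 / fact k * (1 / fact j)))"
      unfolding C_def using z D by (intro mult_left_mono Neumann_term_bound assms) auto
    also have "\<dots> = C * D * (case p of (k, j) \<Rightarrow> z ^ k / fact k * (z ^ j / fact j))"
      by (simp add: p power_add)
    finally show "norm (t p) \<le> C * D * (case p of (k, j) \<Rightarrow> z ^ k / fact k * (z ^ j / fact j))" .
  qed
  then have "t summable_on (UNIV \<times> UNIV)" by (rule abs_summable_summable)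
  then obtain S where S: "(t has_sum S) (UNIV \<times> UNIV)" by (auto simp: summable_on_def)
  \<comment> \<open>Unconditional summability of a row is inherited from the double series;
    comparison with the ordinary series identifies its value.\<close>
  have row: "((\<lambda>j. t (k, j)) has_sum Neumann_coefficient \<nu> k * modified_Bessel_I (2 * real k + \<nu> + 1) x) UNIV" for k
  proof -
    have "(\<lambda>j. t (k, j)) summable_on UNIV"
      using summable_on_SigmaD1[of "\<lambda>k j. t (k, j)" UNIV "\<lambda>_. UNIV" k] S by (auto simp: summable_on_def)
    then obtain R where R: "((\<lambda>j. t (k, j)) has_sum R) UNIV" by (auto simp: summable_on_def)
    have "(\<lambda>j. t (k, j)) sums (Neumann_coefficient \<nu> k * modified_Bessel_I (2 * real k + \<nu> + 1) x)"
      unfolding t_def modified_Bessel_I_def prod.case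
      using assms by (intro sums_mult summable_sums summable_Bessel_I) auto
    then show ?thesis using R has_sum_imp_sums[OF R] sums_unique2 by blast
  qed
  have "((\<lambda>k. Neumann_coefficient \<nu> k * modified_Bessel_I (2 * real k + \<nu> + 1) x) has_sum S) UNIV"
    by (rule has_sum_Sigma'[OF S row])
  then have rows: "(\<lambda>k. Neumann_coefficient \<nu> k * modified_Bessel_I (2 * real k + \<nu> + 1) x) sums S"
    by (rule has_sum_imp_sums)
  \<comment> \<open>The diagonal index is \<open>m = k + j\<close>, so one diagonal is finite and
    collects a single power of \<open>x / 2\<close>.\<close>
  have diag: "((\<lambda>(m, k). t (k, m - k)) has_sum S) (Sigma UNIV (\<lambda>m. {..m}))"
    using S
    by (subst has_sum_reindex_bij_witness[of _ "\<lambda>(k, j). (k + j, k)" "\<lambda>(m, k). (k, m - k)" _ t, OF _ _ _ _ _ refl]) auto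
  \<comment> \<open>With \<open>a = \<nu> + 1\<close> and \<open>b = 1 / 2\<close>, the
    normalization \<open>sqrt pi * Gamma (\<nu> + 1 / 2)\<close> of the coefficients is
    \<open>Gamma b * Gamma (a - b)\<close> and cancels against the identity for the finite
    sum.\<close>
  have col: "(\<Sum>k\<le>m. t (k, m - k)) = (x / 2) powr (2 * real m + \<nu> + 1) /
      (Gamma (real m + 3 / 2) * Gamma (real m + \<nu> + 3 / 2))" for m
  proof -
    have c: "Gamma (1 / 2) * Gamma (\<nu> + 1 / 2) \<noteq> 0"
      using assms Gamma_real_nonzero[of "\<nu> + 1 / 2"] by (simp add: Gamma_one_half_real)
    have "t (k, m - k) = D * z ^ m / (Gamma (1 / 2) * Gamma (\<nu> + 1 / 2)) * ((-1) ^ k * (2 * real k + (\<nu> + 1)) * Gamma (real k + (\<nu> + 1)) /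
      (fact k * fact (m - k) * Gamma (real m + real k + (\<nu> + 1) + 1) * (real k + 1 / 2) * (real k + (\<nu> + 1) - 1 / 2)))"
      if "k \<le> m" for k
    proof -
      have e: "real (m - k) + (2 * real k + \<nu> + 1) + 1 = real m + real k + (\<nu> + 1) + 1"
        "real k + \<nu> + 1 / 2 = real k + (\<nu> + 1) - 1 / 2"
        using that by simp_all
      show ?thesis
        unfolding t_eq Neumann_coefficient_def e Gamma_one_half_real using that by (simp add: mult_ac add_ac)
    qed
    then have "(\<Sum>k\<le>m. t (k, m - k)) = D * z ^ m / (Gamma (1 / 2) * Gamma (\<nu> + 1 / 2)) *
        (Gamma (1 / 2) * Gamma (\<nu> + 1 - 1 / 2) / (Gamma (real m + 1 + 1 / 2) * Gamma (real m + 1 + (\<nu> + 1) - 1 / 2)))"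
      using assms by (subst Neumann_coefficient_sum[symmetric]) (simp_all add: sum_distrib_left)
    also have "\<nu> + 1 - 1 / 2 = \<nu> + 1 / 2" by simp
    also have "real m + 1 + 1 / 2 = real m + 3 / 2" by simp
    also have "real m + 1 + (\<nu> + 1) - 1 / 2 = real m + \<nu> + 3 / 2" by simp
    finally show ?thesis
      using c powr_even_shift[of "x / 2" m "\<nu> + 1"] assms by (simp add: D_def z_def add_ac)
  qed
  have "((\<lambda>m. \<Sum>k\<le>m. t (k, m - k)) has_sum S) UNIV"
    by (rule has_sum_Sigma'[OF diag]) (auto intro!: has_sum_finite)
  then have "(\<lambda>m. \<Sum>k\<le>m. t (k, m - k)) sums S" by (rule has_sum_imp_sums)
  then have "modified_Struve_L \<nu> x = S"
    unfolding col modified_Struve_L_def by (simp add: sums_iff)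
  with rows show ?thesis by simp
qed

section \<open>The function beta: values, differentiability and bounded sums\<close>

lemma struve_beta_of_nat:
  "struve_beta \<nu> (real k) = - complex_of_real (Neumann_coefficient \<nu> k)"
proof -
  have "exp (\<i> * of_real pi * of_real (real k)) = exp (of_nat k * (\<i> * of_real pi))"
    by (simp add: mult_ac)
  also have "\<dots> = (-1) ^ k" unfolding exp_of_nat_mult by simp
  finally have e: "exp (\<i> * of_real pi * of_real (real k)) = (-1) ^ k" .
  have "Gamma (real k + 1) = fact k" using Gamma_fact[of k, where 'a = real] by (simp add: add.commute)
  then show ?thesis
    unfolding struve_beta_def Neumann_coefficient_def e by (simp add: mult_ac)
qed

lemma struve_beta_over_Gamma_differentiable:
  assumes "\<nu> > 0" "s \<ge> 0"
  shows "(\<lambda>s. struve_beta \<nu> s / complex_of_real (Gamma (2 * s + \<nu> + 3 / 2))) differentiable (at s)"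
proof -
  have G: "(\<lambda>s. Gamma (p * s + q)) differentiable (at s)" if "p * s + q > 0" for p q :: real
    using Gamma_affine_has_real_derivative[OF that] by (auto simp: real_differentiable_def)
  \<comment> \<open>The real factor left after splitting off the complex exponential. The Gamma
    arguments are written as \<open>p * s + q\<close>, even for \<open>p = 1\<close>, so that
    \<open>G\<close> applies by unification.\<close>
  define r where "r s = - ((2 * s + \<nu> + 1) * Gamma (1 * s + (\<nu> + 1))) /
      (sqrt pi * Gamma (\<nu> + 1 / 2) * Gamma (1 * s + 1) * (s + 1 / 2) * (s + \<nu> + 1 / 2))
      / Gamma (2 * s + (\<nu> + 3 / 2))" for s
  have nz: "Gamma (\<nu> + 1 / 2) \<noteq> 0" "Gamma (1 * s + 1) \<noteq> 0" "s + 1 / 2 \<noteq> 0" "s + \<nu> + 1 / 2 \<noteq> 0"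
      "Gamma (2 * s + (\<nu> + 3 / 2)) \<noteq> 0"
    using assms by (auto intro!: Gamma_real_nonzero)
  have "r differentiable (at s)"
    unfolding r_def
    by (intro differentiable_divide differentiable_mult differentiable_minus G differentiable_add
          differentiable_const differentiable_ident)
       (use assms nz in \<open>simp_all del: mult_1\<close>)
  then obtain D where "(r has_real_derivative D) (at s)" by (auto simp: real_differentiable_def)
  then have r: "(\<lambda>s. complex_of_real (r s)) differentiable (at s)"
    by (intro differentiableI_vector[OF has_vector_derivative_of_real])
  have e: "(\<lambda>s. exp (\<i> * of_real pi * complex_of_real s)) differentiable (at s)"
    by (rule differentiableI_vector, rule has_vector_derivative_real_field)
       (rule derivative_eq_intros refl | simp)+
  have "(\<lambda>s. exp (\<i> * of_real pi * complex_of_real s) * complex_of_real (r s)) differentiable (at s)"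
    by (intro differentiable_mult e r)
  also have "(\<lambda>s. exp (\<i> * of_real pi * complex_of_real s) * complex_of_real (r s)) =
      (\<lambda>s. struve_beta \<nu> s / complex_of_real (Gamma (2 * s + \<nu> + 3 / 2)))"
    by (simp add: struve_beta_def r_def fun_eq_iff add.assoc)
  finally show ?thesis .
qed

text \<open>Supplies the bound for Abel summation. \<open>Gamma (2 k + \<nu> + 3 / 2)\<close>
  dominates \<open>Gamma (k + \<nu> + 3 / 2)\<close>, and the quotient of
  \<open>Gamma (k + \<nu> + 1)\<close> by the latter is largest at \<open>k = 0\<close>, the value
  used in \<open>B\<close>; a summable \<open>1 / fact k\<close> remains.\<close>

lemma Neumann_coefficient_over_Gamma_sum_bounded:
  assumes "\<nu> > 0"
  shows "\<exists>C. \<forall>n. \<bar>\<Sum>k=1..n. - Neumann_coefficient \<nu> k / Gamma (2 * real k + \<nu> + 3 / 2)\<bar> \<le> C"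
proof (intro exI allI)
  define B where "B = 4 / (sqrt pi * Gamma (\<nu> + 1 / 2)) * (Gamma (\<nu> + 1) / Gamma (\<nu> + 1 + 1 / 2))"
  have B: "B \<ge> 0" using assms by (simp add: B_def)
  have le: "\<bar>- Neumann_coefficient \<nu> k / Gamma (2 * real k + \<nu> + 3 / 2)\<bar> \<le> B * inverse (fact k)" for k
  proof -
    define G H where "G = Gamma (real k + \<nu> + 1)" and "H = Gamma (real k + \<nu> + 1 + 1 / 2)"
    have GH: "G > 0" "H > 0" using assms by (auto simp: G_def H_def)
    have "Gamma (2 * real k + \<nu> + 3 / 2) = pochhammer (real k + \<nu> + 1 + 1 / 2) k * H"
      using Gamma_add_nat_real[of "real k + \<nu> + 1 + 1 / 2" k] assms by (simp add: H_def algebra_simps)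
    moreover have "pochhammer (real k + \<nu> + 1 + 1 / 2) k \<ge> 1"
      using assms by (intro pochhammer_ge_1) auto
    ultimately have H_le: "H \<le> Gamma (2 * real k + \<nu> + 3 / 2)" using GH by simp
    have "\<bar>- Neumann_coefficient \<nu> k / Gamma (2 * real k + \<nu> + 3 / 2)\<bar> =
        \<bar>Neumann_coefficient \<nu> k\<bar> / Gamma (2 * real k + \<nu> + 3 / 2)"
      using H_le GH by simp
    also have "\<dots> \<le> \<bar>Neumann_coefficient \<nu> k\<bar> / H"
      using H_le GH by (intro divide_left_mono) auto
    also have "\<dots> \<le> 4 / (sqrt pi * Gamma (\<nu> + 1 / 2)) * (G / fact k) / H"
      using abs_Neumann_coefficient_le[OF assms, of k] GH by (intro divide_right_mono) (auto simp: G_def)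
    also have "\<dots> = 4 / (sqrt pi * Gamma (\<nu> + 1 / 2)) * (G / H) * inverse (fact k)"
      by (simp add: field_simps)
    also have "\<dots> \<le> B * inverse (fact k)"
      unfolding B_def G_def H_def using assms
      by (intro mult_right_mono mult_left_mono Gamma_ratio_antimono) auto
    finally show ?thesis .
  qed
  fix n
  have "\<bar>\<Sum>k=1..n. - Neumann_coefficient \<nu> k / Gamma (2 * real k + \<nu> + 3 / 2)\<bar> \<le> (\<Sum>k=1..n. B * inverse (fact k))"
    by (rule order_trans[OF sum_abs]) (intro sum_mono le)
  also have "\<dots> \<le> (\<Sum>k. B * inverse (fact k))"
    using summable_exp[of "1 :: real"] B by (intro sum_le_suminf summable_mult) auto
  finally show "\<bar>\<Sum>k=1..n. - Neumann_coefficient \<nu> k / Gamma (2 * real k + \<nu> + 3 / 2)\<bar> \<le> (\<Sum>k. B * inverse (fact k))" .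
qed

section \<open>Assembly of the integral formula\<close>

text \<open>Since \<open>integral\<close> takes a default value where no integral exists, the first
  conjunct asserts that the inner integrals exist; \<open>has_integral\<close> does the same for the
  outer one.\<close>

theorem theorem2:
  fixes \<nu> x :: real
  assumes "\<nu> > 0" and "0 < x" and "x < 2"
  defines "a \<equiv> (\<lambda>s::real. struve_beta \<nu> s / complex_of_real (Gamma (2 * s + \<nu> + 3 / 2)))"
  shows "(\<forall>u\<ge>1. frac_diff_op a integrable_on {0..real_of_int \<lfloor>u::real\<rfloor>}) \<and>
    ((\<lambda>u::real. deriv (\<lambda>v. Gamma (2 * v + \<nu> + 3 / 2) * modified_Bessel_I (2 * v + \<nu> + 1) x) u
        *\<^sub>R integral {0..real_of_int \<lfloor>u\<rfloor>} (frac_diff_op a))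
      has_integral
        complex_of_real (modified_Struve_L \<nu> x
          - 2 * Gamma (\<nu> + 2) / (sqrt pi * Gamma (\<nu> + 3 / 2)) * modified_Bessel_I (\<nu> + 1) x))
      {1..}"
proof -
  define c where "c k = - Neumann_coefficient \<nu> k / Gamma (2 * real k + \<nu> + 3 / 2)" for k
  define G where "G w = Gamma (w + 1 / 2) * modified_Bessel_I w x" for w
  define F where "F v = Gamma (2 * v + \<nu> + 3 / 2) * modified_Bessel_I (2 * v + \<nu> + 1) x" for v
  \<comment> \<open>The order is \<open>w = 2 * v + \<nu> + 1\<close>, for which
    \<open>w + 1 / 2 = 2 * v + \<nu> + 3 / 2\<close>.\<close>
  have FG: "F = (\<lambda>v. G (2 * v + \<nu> + 1))"
    by (simp add: F_def G_def fun_eq_iff add.assoc)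
  have a_nat: "a (real k) = complex_of_real (c k)" for k
    by (simp add: a_def c_def struve_beta_of_nat)
  have inner: "(frac_diff_op a has_integral complex_of_real (\<Sum>k=1..nat \<lfloor>u\<rfloor>. c k)) {0..real_of_int \<lfloor>u\<rfloor>}"
    if "u \<ge> 1" for u :: real
  proof -
    have "real (nat \<lfloor>u\<rfloor>) = real_of_int \<lfloor>u\<rfloor>" using that by simp
    then show ?thesis
      using has_integral_frac_diff_op[of a "nat \<lfloor>u\<rfloor>"] struve_beta_over_Gamma_differentiable[OF assms(1)]
      unfolding a_nat by (simp add: a_def)
  qed
  have F_deriv: "(F has_real_derivative deriv F u) (at u)" if "u \<ge> 1" for u
  proof -
    have "G differentiable (at (2 * u + \<nu> + 1))"
      unfolding G_def[abs_def] using that assms by (intro Gamma_Bessel_I_differentiable) auto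
    then obtain D where D: "(G has_real_derivative D) (at (2 * u + \<nu> + 1))"
      by (auto simp: real_differentiable_def)
    have "(F has_real_derivative D * 2) (at u)"
      unfolding FG by (rule DERIV_chain2[where g = "\<lambda>u. 2 * u + \<nu> + 1", OF D]) (auto intro!: derivative_eq_intros)
    then show ?thesis using DERIV_imp_deriv by metis
  qed
  have F_nonpos: "deriv F u \<le> 0" if "u \<ge> 1" for u
  proof -
    \<comment> \<open>The sign of the derivative is read off from monotonicity on a set that has
      every \<open>u \<ge> 1\<close> in its interior.\<close>
    have "mono_on {0..} (\<lambda>v. - F v)"
      unfolding FG G_def 
      by (intro mono_onI le_imp_neg_le Gamma_Bessel_I_antimono) (use assms in auto)
    then have "- deriv F u \<ge> 0"
      by (rule mono_on_imp_deriv_nonneg) (use that F_deriv in \<open>auto intro!: DERIV_minus\<close>)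
    then show ?thesis by simp
  qed
  have F_lim: "(F \<longlongrightarrow> 0) at_top"
    unfolding FG G_def
  proof (rule filterlim_compose[OF Gamma_Bessel_I_tendsto_0])
    have "filterlim (\<lambda>v. (\<nu> + 1) + 2 * v) at_top at_top"
      by (intro filterlim_tendsto_add_at_top[OF tendsto_const]
            filterlim_tendsto_pos_mult_at_top[OF tendsto_const] filterlim_ident) simp
    then show "filterlim (\<lambda>v. 2 * v + \<nu> + 1) at_top at_top" by (simp add: add_ac)
  qed (use assms in auto)
  obtain C where C: "\<And>n. \<bar>\<Sum>k=1..n. c k\<bar> \<le> C"
    using Neumann_coefficient_over_Gamma_sum_bounded[OF assms(1)] unfolding c_def by blast
  define L where "L = modified_Struve_L \<nu> x
    - 2 * Gamma (\<nu> + 2) / (sqrt pi * Gamma (\<nu> + 3 / 2)) * modified_Bessel_I (\<nu> + 1) x"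
  have cF: "c k * F (real k) = - (Neumann_coefficient \<nu> k * modified_Bessel_I (2 * real k + \<nu> + 1) x)" for k
    using Gamma_real_nonzero[of "2 * real k + \<nu> + 3 / 2"] assms by (simp add: c_def F_def)
  \<comment> \<open>The factor 2 is \<open>1 / (0 + 1 / 2)\<close>; the functional equation of Gamma
    absorbs \<open>\<nu> + 1\<close> and \<open>\<nu> + 1 / 2\<close>.\<close>
  have N0: "Neumann_coefficient \<nu> 0 = 2 * Gamma (\<nu> + 2) / (sqrt pi * Gamma (\<nu> + 3 / 2))"
  proof -
    have "Gamma (\<nu> + 2) = (\<nu> + 1) * Gamma (\<nu> + 1)" "Gamma (\<nu> + 3 / 2) = (\<nu> + 1 / 2) * Gamma (\<nu> + 1 / 2)"
      using Gamma_add_nat_real[of "\<nu> + 1" 1] Gamma_add_nat_real[of "\<nu> + 1 / 2" 1] assms by (simp_all add: add.assoc)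
    then show ?thesis by (simp add: Neumann_coefficient_def mult_ac)
  qed
  have "(\<lambda>k. Neumann_coefficient \<nu> (Suc k) * modified_Bessel_I (2 * real (Suc k) + \<nu> + 1) x) sums L"
    using Neumann_series_Struve_L[OF assms(1,2)] unfolding L_def N0[symmetric]
    by (simp add: sums_Suc_iff[of "\<lambda>k. Neumann_coefficient \<nu> k * modified_Bessel_I (2 * real k + \<nu> + 1) x"] del: of_nat_Suc)
  \<comment> \<open>\<open>c\<close> carries the sign of beta, opposite to the Neumann coefficients;
    the minus sign in Abel summation restores \<open>L\<close>.\<close>
  then have "(\<lambda>k. c (Suc k) * F (real (Suc k))) sums - L"
    unfolding cF by (rule sums_minus)
  from has_integral_Abel_summation_to_inf[OF F_deriv F_nonpos F_lim C this]
  have "((\<lambda>u. deriv F u * (\<Sum>k=1..nat \<lfloor>u\<rfloor>. c k)) has_integral L) {1..}" by simp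
  then have "((\<lambda>u. complex_of_real (deriv F u * (\<Sum>k=1..nat \<lfloor>u\<rfloor>. c k))) has_integral complex_of_real L) {1..}"
    by (rule has_integral_of_real)
  moreover have "complex_of_real (deriv F u * (\<Sum>k=1..nat \<lfloor>u\<rfloor>. c k)) =
      deriv F u *\<^sub>R integral {0..real_of_int \<lfloor>u\<rfloor>} (frac_diff_op a)" if "u \<in> {1..}" for u
    using integral_unique[OF inner[of u]] that by (simp add: scaleR_conv_of_real)
  ultimately have "((\<lambda>u. deriv F u *\<^sub>R integral {0..real_of_int \<lfloor>u\<rfloor>} (frac_diff_op a))
      has_integral complex_of_real L) {1..}"
    by (rule has_integral_eq[rotated])
  then show ?thesis
    using inner unfolding F_def[abs_def] L_def by (auto simp: integrable_on_def)
qed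

end
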